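(* Let $G$ be a connected finite simple graph with vertices $u_1,\dots,u_{\nu_G}$, let $F$ be a connected $r$-regular graph on vertices $v_1,\dots,v_{\nu_F}$, and let $\phi:E(\vec G)\to\mathrm{Aut}(F)$ be a voltage assignment whose values lie in an abelian subgroup $\Gamma$ of $\mathrm{Aut}(F)$. Let $M_\Gamma$ be an invertible matrix such that $M_\Gamma^{-1}P(\gamma)M_\Gamma=\mathrm{diag}(\lambda_{(\gamma,1)},\dots,\lambda_{(\gamma,\nu_F)})$ for all $\gamma\in\Gamma$ and $M_\Gamma^{-1}A(F)M_\Gamma=\mathrm{diag}(\lambda_{(F,1)},\dots,\lambda_{(F,\nu_F)})$. Then for every $\mu\in\mathbb{C}$ the matrix $A(G\times^\phi F)-\mu\mathcal{D}(G\times^\phi F)$ is similar to $$\bigoplus_{i=1}^{\nu_F}\Bigl((\lambda_{(F,i)}-r\mu)I_{\nu_G}+\sum_{\gamma\in\Gamma}\lambda_{(\gamma,i)}A(\vec G_{(\phi,\gamma)})-\mu\mathcal{D}(G)\Bigr).$$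
   Context: For a graph $X$, $A(X)$ is its adjacency matrix and $\mathcal{D}(X)$ its diagonal degree matrix. $\vec G$ is the digraph obtained from $G$ by replacing each edge by two oppositely directed edges; a voltage assignment satisfies $\phi(e^{-1})=\phi(e)^{-1}$. The graph bundle $G\times^\phi F$ has vertex set $V(G)\times V(F)$, with $(u_1,v_1)\sim(u_2,v_2)$ iff either $u_1u_2\in E(\vec G)$ and $v_2=\phi(u_1u_2)(v_1)$, or $u_1=u_2$ and $v_1v_2\in E(F)$. $P(\gamma)$ is the $\nu_F\times\nu_F$ permutation matrix with $(i,j)$-entry $1$ iff $\gamma(v_i)=v_j$. Since the $P(\gamma)$, $\gamma\in\Gamma$, and $A(F)$ are pairwise commuting diagonalizable matrices, such an $M_\Gamma$ exists. $A(\vec G_{(\phi,\gamma)})$ is the $\nu_G\times\nu_G$ matrix with $(a,b)$-entry $1$ if $u_au_b\in E(\vec G)$ and $\phi(u_au_b)=\gamma$, else $0$. *)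

theory Defs
  imports
    "Graph_Theory.Graph_Theory"
    "Jordan_Normal_Form.Matrix"
    "HOL-Algebra.Group"
    "HOL-Combinatorics.Permutations"
begin

text \<open>
  A finite simple graph is a \<^term>\<open>pair_graph\<close>: a finite loopfree symmetric set of arcs. It
  coincides with the digraph obtained by replacing each edge by two opposite arcs, so that
  \<^term>\<open>parcs G\<close> serves both as the adjacency relation of the graph and as the arc set of that
  digraph, the reverse of the arc \<^term>\<open>(u, v)\<close> being \<^term>\<open>(v, u)\<close>. The degree of a vertex is
  its \<^term>\<open>out_degree\<close>.

  Matrices attached to a graph are taken with respect to a listing of its vertices without
  repetition; row and column \<open>i\<close> (counted from 0) belong to the \<open>i\<close>-th vertex of the list.
\<close>

definition vertex_listing :: "'a pair_pre_digraph \<Rightarrow> 'a list \<Rightarrow> bool" where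
  "vertex_listing X xs \<longleftrightarrow> distinct xs \<and> set xs = pverts X"

definition adj_mat :: "'a pair_pre_digraph \<Rightarrow> 'a list \<Rightarrow> complex mat" where
  "adj_mat X xs = mat (length xs) (length xs)
     (\<lambda>(i, j). if (xs ! i, xs ! j) \<in> parcs X then 1 else 0)"

definition degree_mat :: "'a pair_pre_digraph \<Rightarrow> 'a list \<Rightarrow> complex mat" where
  "degree_mat X xs = mat_diag (length xs) (\<lambda>i. of_nat (out_degree (with_proj X) (xs ! i)))"

definition regular_graph :: "'a pair_pre_digraph \<Rightarrow> nat \<Rightarrow> bool" where
  "regular_graph X r \<longleftrightarrow> (\<forall>v \<in> pverts X. out_degree (with_proj X) v = r)"

text \<open>
  Automorphisms are functions that are the identity outside the vertex set, so that each
  automorphism has exactly one representative.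
\<close>

definition aut_group :: "'a pair_pre_digraph \<Rightarrow> ('a \<Rightarrow> 'a) monoid" where
  "aut_group X =
     \<lparr>carrier = {f. f permutes pverts X \<and>
        (\<forall>u \<in> pverts X. \<forall>v \<in> pverts X. (f u, f v) \<in> parcs X \<longleftrightarrow> (u, v) \<in> parcs X)},
      mult = (\<circ>), one = id\<rparr>"

definition voltage_assignment ::
    "'a pair_pre_digraph \<Rightarrow> 'b monoid \<Rightarrow> ('a \<times> 'a \<Rightarrow> 'b) \<Rightarrow> bool" where
  "voltage_assignment G A \<phi> \<longleftrightarrow>
     \<phi> \<in> parcs G \<rightarrow> carrier A \<and>
     (\<forall>(u, v) \<in> parcs G. \<phi> (v, u) = inv\<^bsub>A\<^esub> (\<phi> (u, v)))"

definition graph_bundle ::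
    "'a pair_pre_digraph \<Rightarrow> ('a \<times> 'a \<Rightarrow> 'b \<Rightarrow> 'b) \<Rightarrow> 'b pair_pre_digraph
      \<Rightarrow> ('a \<times> 'b) pair_pre_digraph" where
  "graph_bundle G \<phi> F =
     \<lparr>pverts = pverts G \<times> pverts F,
      parcs = {((u\<^sub>1, v\<^sub>1), (u\<^sub>2, v\<^sub>2)) | u\<^sub>1 v\<^sub>1 u\<^sub>2 v\<^sub>2.
        u\<^sub>1 \<in> pverts G \<and> v\<^sub>1 \<in> pverts F \<and> u\<^sub>2 \<in> pverts G \<and> v\<^sub>2 \<in> pverts F \<and>
        ((u\<^sub>1, u\<^sub>2) \<in> parcs G \<and> v\<^sub>2 = \<phi> (u\<^sub>1, u\<^sub>2) v\<^sub>1 \<or> u\<^sub>1 = u\<^sub>2 \<and> (v\<^sub>1, v\<^sub>2) \<in> parcs F)}\<rparr>"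

definition perm_mat :: "'b list \<Rightarrow> ('b \<Rightarrow> 'b) \<Rightarrow> complex mat" where
  "perm_mat vs \<gamma> = mat (length vs) (length vs) (\<lambda>(i, j). if \<gamma> (vs ! i) = vs ! j then 1 else 0)"

definition voltage_adj_mat ::
    "'a pair_pre_digraph \<Rightarrow> 'a list \<Rightarrow> ('a \<times> 'a \<Rightarrow> 'b) \<Rightarrow> 'b \<Rightarrow> complex mat" where
  "voltage_adj_mat G us \<phi> \<gamma> = mat (length us) (length us)
     (\<lambda>(a, b). if (us ! a, us ! b) \<in> parcs G \<and> \<phi> (us ! a, us ! b) = \<gamma> then 1 else 0)"

lemma group_aut_group: "group (aut_group X)"
proof (rule groupI)
  fix f assume f: "f \<in> carrier (aut_group X)"
  then have p: "f permutes pverts X" by (simp add: aut_group_def)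
  let ?g = "Hilbert_Choice.inv f"
  have "?g permutes pverts X" by (rule permutes_inv[OF p])
  moreover have "(?g u, ?g v) \<in> parcs X \<longleftrightarrow> (u, v) \<in> parcs X"
    if "u \<in> pverts X" "v \<in> pverts X" for u v
  proof -
    have "?g u \<in> pverts X" "?g v \<in> pverts X"
      using that permutes_in_image[OF permutes_inv[OF p]] by auto
    then have "(f (?g u), f (?g v)) \<in> parcs X \<longleftrightarrow> (?g u, ?g v) \<in> parcs X"
      using f by (simp add: aut_group_def)
    then show ?thesis by (simp add: permutes_inverses[OF p])
  qed
  ultimately have "?g \<in> carrier (aut_group X)" by (simp add: aut_group_def)
  moreover have "?g \<otimes>\<^bsub>aut_group X\<^esub> f = \<one>\<^bsub>aut_group X\<^esub>"
    by (simp add: aut_group_def permutes_inv_o[OF p])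
  ultimately show "\<exists>g\<in>carrier (aut_group X). g \<otimes>\<^bsub>aut_group X\<^esub> f = \<one>\<^bsub>aut_group X\<^esub>" by blast
qed (auto simp: aut_group_def permutes_compose permutes_id comp_assoc permutes_in_image)

lemma pair_graph_graph_bundle:
  assumes G: "pair_graph G" and F: "pair_graph F"
    and \<phi>: "voltage_assignment G (aut_group F) \<phi>"
  shows "pair_graph (graph_bundle G \<phi> F)"
proof -
  interpret G: pair_graph G by fact
  interpret F: pair_graph F by fact
  interpret A: group "aut_group F" by (rule group_aut_group)
  have inv: "\<phi> (v, u) (\<phi> (u, v) x) = x" if "(u, v) \<in> parcs G" for u v x
  proof -
    have c: "\<phi> (u, v) \<in> carrier (aut_group F)" and e: "\<phi> (v, u) = inv\<^bsub>aut_group F\<^esub> (\<phi> (u, v))"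
      using \<phi> that by (auto simp: voltage_assignment_def)
    have "\<phi> (v, u) \<otimes>\<^bsub>aut_group F\<^esub> \<phi> (u, v) = \<one>\<^bsub>aut_group F\<^esub>" using c e by simp
    then show ?thesis by (simp add: aut_group_def fun_eq_iff)
  qed
  have symG: "(v, u) \<in> parcs G" if "(u, v) \<in> parcs G" for u v
    using G.pair_sym_arcs that by (auto simp: symmetric_def elim: symE)
  have symF: "(v, u) \<in> parcs F" if "(u, v) \<in> parcs F" for u v
    using F.pair_sym_arcs that by (auto simp: symmetric_def elim: symE)
  have sub: "parcs (graph_bundle G \<phi> F) \<subseteq> (pverts G \<times> pverts F) \<times> (pverts G \<times> pverts F)"
    by (auto simp: graph_bundle_def)
  show ?thesis
  proof
    show "finite (pverts (graph_bundle G \<phi> F))"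
      by (simp add: graph_bundle_def)
    show "finite (parcs (graph_bundle G \<phi> F))"
      by (rule finite_subset[OF sub]) simp
    show "symmetric (with_proj (graph_bundle G \<phi> F))"
      using symG symF inv by (auto simp: symmetric_def graph_bundle_def intro!: symI)
  qed (use sub G.pair_no_loops F.pair_no_loops in \<open>auto simp: graph_bundle_def\<close>)
qed

end

theory Submission
  imports Defs
begin

text \<open>
  Index the rows and columns by pairs \<open>(a, i)\<close>, where \<open>a\<close> numbers a vertex of \<open>G\<close> and \<open>i\<close> a vertex
  of \<open>F\<close>. The bundle matrix has \<open>((a, i), (b, j))\<close>-entry
  \<open>\<delta>\<^sub>a\<^sub>b A(F)\<^sub>i\<^sub>j + A(G)\<^sub>a\<^sub>b P(\<phi>(u\<^sub>a u\<^sub>b))\<^sub>i\<^sub>j - \<mu> \<delta>\<^sub>a\<^sub>b \<delta>\<^sub>i\<^sub>j (deg u\<^sub>a + r)\<close>,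
  since the degree of \<open>(u, v)\<close> in the bundle is \<open>deg u + r\<close>. Conjugation by \<open>I \<otimes> M\<close> diagonalizes
  every \<open>i, j\<close>-block simultaneously, and reordering the pairs by their second component displays
  the result as a direct sum over \<open>i\<close>.
\<close>

section \<open>Matrices read through an enumeration of an index set\<close>

definition indexed_mat ::
    "nat \<Rightarrow> (nat \<Rightarrow> 'i) \<Rightarrow> (nat \<Rightarrow> 'j) \<Rightarrow> ('i \<Rightarrow> 'j \<Rightarrow> 'c) \<Rightarrow> 'c mat" where
  "indexed_mat N \<alpha> \<beta> f = mat N N (\<lambda>(p, k). f (\<alpha> p) (\<beta> k))"

lemma indexed_mat_carrier [simp]: "indexed_mat N \<alpha> \<beta> f \<in> carrier_mat N N"
  by (simp add: indexed_mat_def)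

lemma indexed_mat_cong:
  assumes "bij_betw \<alpha> {..<N} T" and "bij_betw \<beta> {..<N} U"
    and "\<And>x y. x \<in> T \<Longrightarrow> y \<in> U \<Longrightarrow> f x y = g x y"
  shows "indexed_mat N \<alpha> \<beta> f = indexed_mat N \<alpha> \<beta> g"
  using assms by (auto simp: indexed_mat_def dest!: bij_betwE intro!: eq_matI)

text \<open>The middle enumeration enters only through a reindexing of the sum, so a product becomes
  a sum over \<open>T\<close> itself. Later computations can thus use pairs of vertex positions
  instead of row and column numbers.\<close>

lemma indexed_mat_mult:
  fixes f :: "'i \<Rightarrow> 'j \<Rightarrow> 'c::semiring_0"
  assumes "bij_betw \<beta> {..<N} T"
  shows "indexed_mat N \<alpha> \<beta> f * indexed_mat N \<beta> \<delta> g
    = indexed_mat N \<alpha> \<delta> (\<lambda>x z. \<Sum>y\<in>T. f x y * g y z)"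
proof (rule eq_matI)
  fix p k assume "p < dim_row (indexed_mat N \<alpha> \<delta> (\<lambda>x z. \<Sum>y\<in>T. f x y * g y z))"
    and "k < dim_col (indexed_mat N \<alpha> \<delta> (\<lambda>x z. \<Sum>y\<in>T. f x y * g y z))"
  then have pk: "p < N" "k < N" by (simp_all add: indexed_mat_def)
  have "(indexed_mat N \<alpha> \<beta> f * indexed_mat N \<beta> \<delta> g) $$ (p, k)
      = (\<Sum>l<N. f (\<alpha> p) (\<beta> l) * g (\<beta> l) (\<delta> k))"
    using pk by (simp add: indexed_mat_def scalar_prod_def lessThan_atLeast0)
  also have "\<dots> = (\<Sum>y\<in>T. f (\<alpha> p) y * g y (\<delta> k))"
    by (rule sum.reindex_bij_betw[OF assms])
  finally show "(indexed_mat N \<alpha> \<beta> f * indexed_mat N \<beta> \<delta> g) $$ (p, k)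
      = indexed_mat N \<alpha> \<delta> (\<lambda>x z. \<Sum>y\<in>T. f x y * g y z) $$ (p, k)"
    using pk by (simp add: indexed_mat_def)
qed (simp_all add: indexed_mat_def)

lemma indexed_mat_one:
  assumes "bij_betw \<alpha> {..<N} T"
  shows "indexed_mat N \<alpha> \<alpha> (\<lambda>x y. if x = y then 1 else 0) = 1\<^sub>m N"
  using bij_betw_imp_inj_on[OF assms]
  by (auto simp: indexed_mat_def inj_on_eq_iff intro!: eq_matI)

text \<open>The conjugating matrix has its rows listed by \<open>\<alpha>\<close> and its columns by
  \<open>\<beta>\<close>; it therefore combines the change of basis \<open>S\<close> with the
  permutation between the two enumerations. The intertwining relation \<open>fS\<close> avoids
  computing a triple product.\<close>

lemma similar_mat_indexed_mat:
  fixes f g S Q :: "'i \<Rightarrow> 'i \<Rightarrow> 'c::semiring_1"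
  assumes \<alpha>: "bij_betw \<alpha> {..<N} T" and \<beta>: "bij_betw \<beta> {..<N} T"
    and SQ: "\<And>x z. x \<in> T \<Longrightarrow> z \<in> T \<Longrightarrow> (\<Sum>y\<in>T. S x y * Q y z) = (if x = z then 1 else 0)"
    and QS: "\<And>x z. x \<in> T \<Longrightarrow> z \<in> T \<Longrightarrow> (\<Sum>y\<in>T. Q x y * S y z) = (if x = z then 1 else 0)"
    and fS: "\<And>x z. x \<in> T \<Longrightarrow> z \<in> T \<Longrightarrow> (\<Sum>y\<in>T. f x y * S y z) = (\<Sum>y\<in>T. S x y * g y z)"
  shows "similar_mat (indexed_mat N \<alpha> \<alpha> f) (indexed_mat N \<beta> \<beta> g)"
proof -
  let ?P = "indexed_mat N \<alpha> \<beta> S" and ?Q = "indexed_mat N \<beta> \<alpha> Q"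
  let ?A = "indexed_mat N \<alpha> \<alpha> f" and ?B = "indexed_mat N \<beta> \<beta> g"
  have PQ: "?P * ?Q = 1\<^sub>m N"
    unfolding indexed_mat_mult[OF \<beta>] indexed_mat_one[OF \<alpha>, symmetric]
    by (rule indexed_mat_cong[OF \<alpha> \<alpha> SQ])
  have QP: "?Q * ?P = 1\<^sub>m N"
    unfolding indexed_mat_mult[OF \<alpha>] indexed_mat_one[OF \<beta>, symmetric]
    by (rule indexed_mat_cong[OF \<beta> \<beta> QS])
  have AP: "?A * ?P = ?P * ?B"
    unfolding indexed_mat_mult[OF \<alpha>] indexed_mat_mult[OF \<beta>]
    by (rule indexed_mat_cong[OF \<alpha> \<beta> fS])
  have "?A = ?A * (?P * ?Q)" by (simp add: PQ right_mult_one_mat[of _ N N])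
  also have "\<dots> = ?A * ?P * ?Q" by (simp add: assoc_mult_mat[of _ N N _ N _ N])
  finally have "?A = ?P * ?B * ?Q" by (simp only: AP)
  then show ?thesis by (rule similar_matI[OF _ PQ QP, rotated]) simp
qed

section \<open>Entries of direct sums with equal block sizes and of finite matrix sums\<close>

lemma diag_block_mat_uniform_carrier:
  assumes "\<And>i. i < length As \<Longrightarrow> As ! i \<in> carrier_mat n n"
  shows "diag_block_mat As \<in> carrier_mat (length As * n) (length As * n)"
proof -
  have "\<forall>A\<in>set As. dim_row A = n \<and> dim_col A = n"
    using assms by (metis carrier_matD in_set_conv_nth)
  then have "map dim_row As = replicate (length As) n" "map dim_col As = replicate (length As) n"
    by (simp_all add: list_eq_iff_nth_eq)
  then show ?thesis by (intro carrier_matI) (simp_all only: dim_diag_block_mat sum_list_replicate of_nat_id)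
qed

text \<open>Induction on the list, peeling off the first block: subtracting \<open>n\<close> from a
  coordinate lowers its block number by one and keeps its position inside the block.\<close>

lemma index_diag_block_mat_uniform:
  fixes As :: "'c::zero mat list"
  assumes "\<And>i. i < length As \<Longrightarrow> As ! i \<in> carrier_mat n n"
    and "p < length As * n" and "q < length As * n"
  shows "diag_block_mat As $$ (p, q)
    = (if p div n = q div n then As ! (p div n) $$ (p mod n, q mod n) else 0)"
  using assms
proof (induction As arbitrary: p q)
  case Nil
  then show ?case by simp
next
  case (Cons A As)
  have n: "n > 0" using Cons.prems(2) by (cases n) auto
  have A: "A \<in> carrier_mat n n" using Cons.prems(1)[of 0] by simp
  have As: "As ! i \<in> carrier_mat n n" if "i < length As" for i
    using Cons.prems(1)[of "Suc i"] that by simp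
  have D: "diag_block_mat As \<in> carrier_mat (length As * n) (length As * n)"
    by (rule diag_block_mat_uniform_carrier) (rule As)
  have shift: "k div n = Suc ((k - n) div n)" "k mod n = (k - n) mod n" if "\<not> k < n" for k
    using that n by (simp_all add: le_div_geq le_mod_geq)
  show ?case
  \<comment> \<open>If a coordinate falls into the first block, the entry comes from
    \<open>A\<close> or from a zero block beside it. Otherwise both coordinates lie in the remaining
    direct sum.\<close>
  proof (cases "p < n \<or> q < n")
    case True
    then show ?thesis
      using A D Cons.prems(2,3) n shift[of p] shift[of q]
      by (auto simp: Let_def)
  next
    case False
    then have "diag_block_mat As $$ (p - n, q - n)
      = (if (p - n) div n = (q - n) div n
         then As ! ((p - n) div n) $$ ((p - n) mod n, (q - n) mod n) else 0)"
      using Cons.prems(2,3) by (intro Cons.IH As) auto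
    then show ?thesis
      using False A D Cons.prems(2,3) n shift[of p] shift[of q]
      by (auto simp: Let_def)
  qed
qed

text \<open>Matrix sums are taken in the abelian group of matrices of one fixed size, whose zero has
  that size. This translates them into ordinary sums of entries.\<close>

lemma finsum_module_mat:
  fixes f :: "'i \<Rightarrow> 'c::comm_ring_1 mat"
  assumes "finite I" and "\<And>x. x \<in> I \<Longrightarrow> f x \<in> carrier_mat nr nc"
  shows "finsum (module_mat TYPE('c) nr nc) f I = mat nr nc (\<lambda>ij. \<Sum>x\<in>I. f x $$ ij)"
  using assms
proof (induction I)
  case empty
  interpret abelian_group "module_mat TYPE('c) nr nc" by (rule abelian_group_mat)
  have "0\<^sub>m nr nc = mat nr nc (\<lambda>ij. \<Sum>x\<in>{}. f x $$ ij)" by (intro eq_matI) simp_all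
  then show ?case by (simp only: finsum_empty module_mat_simps)
next
  case (insert x I)
  interpret abelian_group "module_mat TYPE('c) nr nc" by (rule abelian_group_mat)
  have "finsum (module_mat TYPE('c) nr nc) f (insert x I)
      = f x + finsum (module_mat TYPE('c) nr nc) f I"
    using insert.hyps insert.prems
    by (subst finsum_insert) (auto simp: module_mat_simps)
  also have "finsum (module_mat TYPE('c) nr nc) f I = mat nr nc (\<lambda>ij. \<Sum>x\<in>I. f x $$ ij)"
    using insert.IH insert.prems by simp
  also have "f x + \<dots> = mat nr nc (\<lambda>ij. \<Sum>x\<in>insert x I. f x $$ ij)"
    using insert.hyps insert.prems[of x] by (intro eq_matI) simp_all
  finally show ?case .
qed

text \<open>The pair is (position inside the block, number of the block), so the second component
  selects the direct summand. The inverse is \<open>i * n + a\<close>.\<close>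

lemma bij_betw_div_mod:
  fixes m n :: nat
  shows "bij_betw (\<lambda>k. (k mod n, k div n)) {..<m * n} ({..<n} \<times> {..<m})"
proof (rule bij_betw_byWitness[where f' = "\<lambda>(a, i). i * n + a"])
  show "(\<lambda>k. (k mod n, k div n)) ` {..<m * n} \<subseteq> {..<n} \<times> {..<m}"
    by (cases "n = 0") (auto simp: less_mult_imp_div_less)
  show "(\<lambda>(a, i). i * n + a) ` ({..<n} \<times> {..<m}) \<subseteq> {..<m * n}"
  proof clarsimp
    fix a i assume "a < n" "i < m"
    then have "i * n + a < Suc i * n" by simp
    also have "\<dots> \<le> m * n" using \<open>i < m\<close> by (intro mult_le_mono1) simp
    finally show "i * n + a < m * n" .
  qed
qed simp_all

section \<open>Degrees in the graph bundle\<close>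

lemma out_degree_graph_bundle:
  assumes G: "pair_graph G" and F: "pair_graph F"
    and \<phi>: "voltage_assignment G (aut_group F) \<phi>"
    and u: "u \<in> pverts G" and v: "v \<in> pverts F"
  shows "out_degree (with_proj (graph_bundle G \<phi> F)) (u, v)
    = out_degree (with_proj G) u + out_degree (with_proj F) v"
proof -
  interpret G: pair_graph G by fact
  interpret F: pair_graph F by fact
  let ?g = "\<lambda>e. ((u, v), (snd e, \<phi> (u, snd e) v))" and ?f = "\<lambda>e. ((u, v), (u, snd e))"
  have im: "\<phi> (u, w) v \<in> pverts F" if "(u, w) \<in> parcs G" for w
  proof -
    have "\<phi> (u, w) permutes pverts F"
      using \<phi> that by (auto simp: voltage_assignment_def aut_group_def)
    then show ?thesis using v by (simp add: permutes_in_image)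
  qed
  \<comment> \<open>An arc leaving \<open>(u, v)\<close> either lifts an arc of \<open>G\<close> at
    \<open>u\<close>, with its head in the fibre determined by the voltage, or stays in the fibre
    over \<open>u\<close> and follows an arc of \<open>F\<close> at \<open>v\<close>.\<close>
  have arcs: "out_arcs (with_proj (graph_bundle G \<phi> F)) (u, v)
      = ?g ` out_arcs (with_proj G) u \<union> ?f ` out_arcs (with_proj F) v"
    using u v im G.in_arcsD2 F.in_arcsD2
    by (auto simp: out_arcs_def graph_bundle_def image_iff Bex_def)
  have "inj_on ?g (out_arcs (with_proj G) u)" "inj_on ?f (out_arcs (with_proj F) v)"
    by (auto simp: inj_on_def out_arcs_def)
  \<comment> \<open>A common arc would project to a loop at \<open>u\<close> in
    \<open>G\<close>.\<close>
  moreover have "?g ` out_arcs (with_proj G) u \<inter> ?f ` out_arcs (with_proj F) v = {}"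
    using G.no_loops'[of u u] by (auto simp: out_arcs_def)
  moreover have "finite (out_arcs (with_proj G) u)" "finite (out_arcs (with_proj F) v)"
    by (auto simp: out_arcs_def)
  ultimately show ?thesis
    unfolding out_degree_def arcs by (simp add: card_Un_disjoint card_image)
qed

section \<open>Diagonalization and inverses in terms of entries\<close>

lemma mult_eq_mult_mat_diag:
  fixes M :: "'c::semiring_1 mat"
  assumes "M \<in> carrier_mat m m" "Minv \<in> carrier_mat m m" "X \<in> carrier_mat m m"
    and "inverts_mat M Minv" and "Minv * X * M = mat_diag m l"
    and "i < m" "j < m"
  shows "(\<Sum>k<m. X $$ (i, k) * M $$ (k, j)) = M $$ (i, j) * l j"
proof -
  \<comment> \<open>Inserting \<open>M * Minv\<close> turns the conjugation identity into
    \<open>X * M = M * mat_diag m l\<close>: column \<open>j\<close> of \<open>M\<close> is an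
    eigenvector of \<open>X\<close> for \<open>l j\<close>.\<close>
  have "X * M = M * Minv * (X * M)"
    using assms by (simp add: inverts_mat_def left_mult_one_mat[of _ m m])
  also have "\<dots> = M * (Minv * X * M)"
    using assms(1-3) by (simp add: assoc_mult_mat[of _ m m _ m _ m])
  finally have "X * M = M * mat_diag m l" using assms(5) by simp
  then have "(X * M) $$ (i, j) = M $$ (i, j) * l j"
    using assms(1,6,7) by (simp add: mat_diag_mult_right)
  then show ?thesis
    using assms by (simp add: scalar_prod_def lessThan_atLeast0)
qed

lemma inverts_mat_sum:
  fixes M :: "'c::semiring_1 mat"
  assumes "M \<in> carrier_mat m m" "Minv \<in> carrier_mat m m" "inverts_mat M Minv" "i < m" "j < m"
  shows "(\<Sum>k<m. M $$ (i, k) * Minv $$ (k, j)) = (if i = j then 1 else 0)"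
proof -
  have "(M * Minv) $$ (i, j) = 1\<^sub>m m $$ (i, j)" using assms by (simp add: inverts_mat_def)
  then show ?thesis using assms by (simp add: scalar_prod_def lessThan_atLeast0)
qed

section \<open>Similarity of the bundle matrix to the direct sum\<close>

theorem theorem3p6:
  fixes G :: "'a pair_pre_digraph" and F :: "'b pair_pre_digraph"
    and us :: "'a list" and vs :: "'b list" and ws :: "('a \<times> 'b) list"
    and r :: nat
    and \<Gamma> :: "('b \<Rightarrow> 'b) set" and \<phi> :: "'a \<times> 'a \<Rightarrow> 'b \<Rightarrow> 'b"
    and M Minv :: "complex mat"
    and lam :: "('b \<Rightarrow> 'b) \<Rightarrow> nat \<Rightarrow> complex" and lamF :: "nat \<Rightarrow> complex"
    and \<mu> :: complex
  assumes "pair_graph G" and "connected (with_proj G)" and "vertex_listing G us"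
    and "pair_graph F" and "connected (with_proj F)" and "regular_graph F r"
    and "vertex_listing F vs"
    and "voltage_assignment G (aut_group F) \<phi>"
    and "subgroup \<Gamma> (aut_group F)" and "comm_group (aut_group F \<lparr>carrier := \<Gamma>\<rparr>)"
    and "\<phi> ` parcs G \<subseteq> \<Gamma>"
    and "M \<in> carrier_mat (length vs) (length vs)" and "Minv \<in> carrier_mat (length vs) (length vs)"
    and "inverts_mat M Minv" and "inverts_mat Minv M"
    and "\<And>\<gamma>. \<gamma> \<in> \<Gamma> \<Longrightarrow> Minv * perm_mat vs \<gamma> * M = mat_diag (length vs) (lam \<gamma>)"
    and "Minv * adj_mat F vs * M = mat_diag (length vs) lamF"
    and "vertex_listing (graph_bundle G \<phi> F) ws"
  shows "similar_mat
    (adj_mat (graph_bundle G \<phi> F) ws - \<mu> \<cdot>\<^sub>m degree_mat (graph_bundle G \<phi> F) ws)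
    (diag_block_mat (map (\<lambda>i.
       (lamF i - of_nat r * \<mu>) \<cdot>\<^sub>m 1\<^sub>m (length us)
       + finsum (module_mat TYPE(complex) (length us) (length us))
           (\<lambda>\<gamma>. lam \<gamma> i \<cdot>\<^sub>m voltage_adj_mat G us \<phi> \<gamma>) \<Gamma>
       - \<mu> \<cdot>\<^sub>m degree_mat G us) [0..<length vs]))"
proof -
  note graphs = assms(1,4) and voltage = assms(8) and M = assms(12-15)
  interpret G: pair_graph G by fact
  interpret F: pair_graph F by fact
  define n m where "n = length us" and "m = length vs"
  define T where "T = {..<n} \<times> {..<m}"
  let ?E = "graph_bundle G \<phi> F"
  let ?deg = "\<lambda>a. of_nat (out_degree (with_proj G) (us ! a)) :: complex"
  let ?arc = "\<lambda>a b. (us ! a, us ! b) \<in> parcs G"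
  let ?volt = "\<lambda>a b. \<phi> (us ! a, us ! b)"

  have us: "distinct us" "set us = pverts G" and vs: "distinct vs" "set vs = pverts F"
    and ws: "distinct ws" "set ws = pverts G \<times> pverts F"
    using assms(3,7,18) by (auto simp: vertex_listing_def graph_bundle_def)
  have us_nth: "us ! a \<in> pverts G" if "a < n" for a
    using nth_mem[of a us] that by (simp only: us n_def)
  have vs_nth: "vs ! i \<in> pverts F" if "i < m" for i
    using nth_mem[of i vs] that by (simp only: vs m_def)
  have us_eq: "us ! a = us ! b \<longleftrightarrow> a = b" if "a < n" "b < n" for a b
    using nth_eq_iff_index_eq[OF us(1)] that by (simp only: n_def)
  have N: "length ws = m * n"
    using distinct_card[OF ws(1)] distinct_card[OF us(1)] distinct_card[OF vs(1)] us(2) vs(2) ws(2)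
    by (simp add: n_def m_def card_cartesian_product mult.commute)

  \<comment> \<open>The listing \<open>ws\<close> may order the product in any way. Through
    \<open>h\<close>, the map \<open>\<alpha>\<close> sends a position in \<open>ws\<close> to the
    pair of positions in \<open>us\<close> and \<open>vs\<close>.\<close>
  define h where "h = (\<lambda>(a, i). (us ! a, vs ! i))"
  have h: "bij_betw h T (set ws)"
    using bij_betw_map_prod[OF bij_betw_nth[OF us(1) refl refl] bij_betw_nth[OF vs(1) refl refl]]
    by (simp add: T_def h_def n_def m_def ws us vs map_prod_def lessThan_atLeast0)
  define \<alpha> where "\<alpha> = inv_into T h \<circ> (!) ws"
  have \<alpha>: "bij_betw \<alpha> {..<m * n} T"
    unfolding \<alpha>_def using bij_betw_nth[OF ws(1)] N bij_betw_inv_into[OF h]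
    by (intro bij_betw_trans[where B = "set ws"]) auto
  have h_\<alpha>: "ws ! p = h (\<alpha> p)" if "p < m * n" for p
    using that N bij_betw_inv_into_right[OF h, of "ws ! p"] by (simp add: \<alpha>_def)

  \<comment> \<open>\<open>\<beta>\<close> is the enumeration dictated by the direct sum: the
    remainder is a position in \<open>us\<close>, the quotient the index of the summand.\<close>
  define \<beta> where "\<beta> k = (k mod n, k div n)" for k
  have \<beta>: "bij_betw \<beta> {..<m * n} T"
    unfolding \<beta>_def T_def by (rule bij_betw_div_mod)

  define f where "f = (\<lambda>(a, i) (b, j).
      (if a = b then adj_mat F vs $$ (i, j) else 0)
      + (if ?arc a b then perm_mat vs (?volt a b) $$ (i, j) else 0)
      - (if a = b \<and> i = j then \<mu> * (?deg a + of_nat r) else 0))"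
  \<comment> \<open>\<open>c i a b\<close> is the \<open>(a, b)\<close>-entry of the summand with
    index \<open>i\<close>, where the sum over \<open>\<Gamma>\<close> has already collapsed to the
    voltage of the arc.\<close>
  define c where "c i a b = (if a = b then lamF i - of_nat r * \<mu> - \<mu> * ?deg a else 0)
      + (if ?arc a b then lam (?volt a b) i else 0)" for i a b
  define g where "g = (\<lambda>(a, i) (b, j). if i = j then c i a b else 0)"
  \<comment> \<open>\<open>S\<close> and \<open>Q\<close> are the kernels of the Kronecker products
    of the identity with \<open>M\<close> and with \<open>Minv\<close>.\<close>
  define S where "S = (\<lambda>(a::nat, i) (b, j). if a = b then M $$ (i, j) else 0)"
  define Q where "Q = (\<lambda>(a::nat, i) (b, j). if a = b then Minv $$ (i, j) else 0)"

  have A: "adj_mat ?E ws - \<mu> \<cdot>\<^sub>m degree_mat ?E ws = indexed_mat (m * n) \<alpha> \<alpha> f" (is "?A = _")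
  proof (rule eq_matI)
    fix p q assume "p < dim_row (indexed_mat (m * n) \<alpha> \<alpha> f)"
      and "q < dim_col (indexed_mat (m * n) \<alpha> \<alpha> f)"
    then have pq: "p < m * n" "q < m * n" by (simp_all add: indexed_mat_def)
    obtain a i b j where ab: "\<alpha> p = (a, i)" "\<alpha> q = (b, j)" by fastforce
    have lt: "a < n" "i < m" "b < n" "j < m"
      using pq ab bij_betwE[OF \<alpha>] by (force simp: T_def)+
    have p: "ws ! p = (us ! a, vs ! i)" and q: "ws ! q = (us ! b, vs ! j)"
      using h_\<alpha> pq ab by (auto simp: h_def)
    have "p = q \<longleftrightarrow> a = b \<and> i = j"
      using inj_on_eq_iff[OF bij_betw_imp_inj_on[OF \<alpha>], of p q] pq ab by auto
    moreover have "of_nat (out_degree (with_proj ?E) (us ! a, vs ! i)) = ?deg a + of_nat r"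
      using out_degree_graph_bundle[OF graphs voltage us_nth vs_nth, OF lt(1,2)]
        \<open>regular_graph F r\<close> vs_nth[OF lt(2)] by (simp add: regular_graph_def)
    moreover have "((us ! a, vs ! i), (us ! b, vs ! j)) \<in> parcs ?E
      \<longleftrightarrow> ?arc a b \<and> ?volt a b (vs ! i) = vs ! j \<or> a = b \<and> (vs ! i, vs ! j) \<in> parcs F"
      using us_nth vs_nth us_eq lt by (auto simp: graph_bundle_def)
    \<comment> \<open>The two alternatives of adjacency in the bundle thus exclude each other, so
      its 0/1 entry is the sum of the two adjacency terms of \<open>f\<close>.\<close>
    moreover have "\<not> ?arc a a" using G.no_loops'[of "us ! a" "us ! a"] by auto
    ultimately show "?A $$ (p, q) = indexed_mat (m * n) \<alpha> \<alpha> f $$ (p, q)"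
      using pq lt ab p q N
      by (auto simp: indexed_mat_def f_def adj_mat_def degree_mat_def perm_mat_def mat_diag_def
          m_def[symmetric])
  qed (simp_all add: indexed_mat_def adj_mat_def degree_mat_def mat_diag_def N)

  let ?B = "\<lambda>i. (lamF i - of_nat r * \<mu>) \<cdot>\<^sub>m 1\<^sub>m (length us)
       + finsum (module_mat TYPE(complex) (length us) (length us))
           (\<lambda>\<gamma>. lam \<gamma> i \<cdot>\<^sub>m voltage_adj_mat G us \<phi> \<gamma>) \<Gamma>
       - \<mu> \<cdot>\<^sub>m degree_mat G us"
  \<comment> \<open>Permutations of a finite vertex set form a finite set. Over an infinite set
    \<open>finsum\<close> would be the default zero.\<close>
  have "\<Gamma> \<subseteq> {\<gamma>. \<gamma> permutes pverts F}"
    using subgroup.subset[OF assms(9)] by (auto simp: aut_group_def)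
  then have fin: "finite \<Gamma>" by (rule finite_subset) (simp add: finite_permutations)
  have B_entry: "?B i = mat n n (\<lambda>(a, b). c i a b)" for i
  proof -
    have "finsum (module_mat TYPE(complex) n n) (\<lambda>\<gamma>. lam \<gamma> i \<cdot>\<^sub>m voltage_adj_mat G us \<phi> \<gamma>) \<Gamma>
      = mat n n (\<lambda>(a, b). if ?arc a b then lam (?volt a b) i else 0)"
    proof (subst finsum_module_mat[OF fin])
      show "mat n n (\<lambda>ij. \<Sum>\<gamma>\<in>\<Gamma>. (lam \<gamma> i \<cdot>\<^sub>m voltage_adj_mat G us \<phi> \<gamma>) $$ ij)
        = mat n n (\<lambda>(a, b). if ?arc a b then lam (?volt a b) i else 0)"
      proof (rule eq_matI; clarsimp)
        fix a b assume ab: "a < n" "b < n"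
        \<comment> \<open>An arc carries exactly one voltage, and it lies in
          \<open>\<Gamma>\<close>, so a single term survives. The test on the voltage is put
          outermost to make the sum a delta sum.\<close>
        have "(\<Sum>\<gamma>\<in>\<Gamma>. (lam \<gamma> i \<cdot>\<^sub>m voltage_adj_mat G us \<phi> \<gamma>) $$ (a, b))
          = (\<Sum>\<gamma>\<in>\<Gamma>. if ?volt a b = \<gamma> then if ?arc a b then lam \<gamma> i else 0 else 0)"
          using ab by (intro sum.cong) (auto simp: voltage_adj_mat_def n_def)
        also have "\<dots> = (if ?arc a b then lam (?volt a b) i else 0)"
          using fin assms(11) by (auto simp: sum.delta)
        finally show "(?arc a b \<longrightarrow> (\<Sum>\<gamma>\<in>\<Gamma>. (lam \<gamma> i \<cdot>\<^sub>m voltage_adj_mat G us \<phi> \<gamma>) $$ (a, b))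
              = lam (?volt a b) i)
          \<and> (\<not> ?arc a b \<longrightarrow> (\<Sum>\<gamma>\<in>\<Gamma>. (lam \<gamma> i \<cdot>\<^sub>m voltage_adj_mat G us \<phi> \<gamma>) $$ (a, b)) = 0)"
          by simp
      qed
    qed (simp add: voltage_adj_mat_def n_def)
    then show ?thesis
      by (auto simp: n_def[symmetric] c_def degree_mat_def mat_diag_def intro!: eq_matI)
  qed
  have B: "diag_block_mat (map ?B [0..<length vs]) = indexed_mat (m * n) \<beta> \<beta> g" (is "?D = _")
  proof (rule eq_matI)
    have len: "length (map ?B [0..<length vs]) = m" by (simp add: m_def)
    have car: "map ?B [0..<length vs] ! i \<in> carrier_mat n n"
      if "i < length (map ?B [0..<length vs])" for i
      using that unfolding B_entry by simp
    show "dim_row ?D = dim_row (indexed_mat (m * n) \<beta> \<beta> g)"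
      and "dim_col ?D = dim_col (indexed_mat (m * n) \<beta> \<beta> g)"
      using diag_block_mat_uniform_carrier[OF car] len by (simp_all add: indexed_mat_def)
    fix p q assume "p < dim_row (indexed_mat (m * n) \<beta> \<beta> g)"
      and "q < dim_col (indexed_mat (m * n) \<beta> \<beta> g)"
    then have pq: "p < m * n" "q < m * n" by (simp_all add: indexed_mat_def)
    then have "p div n < m" "0 < n" by (auto simp: less_mult_imp_div_less intro: Nat.gr0I)
    then show "?D $$ (p, q) = indexed_mat (m * n) \<beta> \<beta> g $$ (p, q)"
      using pq index_diag_block_mat_uniform[OF car, of p q, unfolded len, OF _ pq]
      by (simp add: B_entry m_def[symmetric] indexed_mat_def \<beta>_def g_def)
  qed

  show ?thesis
    unfolding A B
  proof (rule similar_mat_indexed_mat[OF \<alpha> \<beta>, where S = S and Q = Q])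
    fix x z assume "x \<in> T" "z \<in> T"
    then obtain a i b j where xz: "x = (a, i)" "z = (b, j)"
      and lt: "a < n" "i < m" "b < n" "j < m" by (auto simp: T_def)
    \<comment> \<open>Splitting the sum over pairs lets the delta in the \<open>G\<close>-coordinate
      remove the outer sum, which leaves a sum over positions in \<open>vs\<close>.\<close>
    have collapse: "(\<Sum>y\<in>T. w y) = (\<Sum>d<n. \<Sum>k<m. w (d, k))" for w :: "nat \<times> nat \<Rightarrow> complex"
      unfolding T_def by (simp add: sum.cartesian_product)
    have pull: "(\<Sum>k<m. if P then w k else 0) = (if P then \<Sum>k<m. w k else 0)"
      for P and w :: "nat \<Rightarrow> complex" by simp
    show "(\<Sum>y\<in>T. S x y * Q y z) = (if x = z then 1 else 0)"
      using lt inverts_mat_sum[OF M(1,2,3), of i j]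
      by (cases "a = b") (simp_all add: collapse xz S_def Q_def pull m_def[symmetric]
          if_distrib[of "\<lambda>t. t * _"] cong: if_cong)
    show "(\<Sum>y\<in>T. Q x y * S y z) = (if x = z then 1 else 0)"
      using lt inverts_mat_sum[OF M(2,1,4), of i j]
      by (cases "a = b") (simp_all add: collapse xz S_def Q_def pull m_def[symmetric]
          if_distrib[of "\<lambda>t. t * _"] cong: if_cong)
    \<comment> \<open>Column \<open>j\<close> of \<open>M\<close> is a common eigenvector of
      \<open>A(F)\<close> and of all \<open>P(\<gamma>)\<close> with \<open>\<gamma>\<close> in
      \<open>\<Gamma>\<close>, in particular for the voltages of arcs.\<close>
    have FM: "(\<Sum>k<m. adj_mat F vs $$ (i, k) * M $$ (k, j)) = M $$ (i, j) * lamF j"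
      using M lt assms(17)
      by (intro mult_eq_mult_mat_diag[where Minv = Minv]) (auto simp: m_def adj_mat_def)
    have PM: "(\<Sum>k<m. perm_mat vs (?volt a b) $$ (i, k) * M $$ (k, j))
        = M $$ (i, j) * lam (?volt a b) j" if "?arc a b"
      using M lt assms(16)[of "?volt a b"] assms(11) that
      by (intro mult_eq_mult_mat_diag[where Minv = Minv]) (auto simp: m_def perm_mat_def)
    \<comment> \<open>Only \<open>y = (b, k)\<close> contributes, since \<open>S\<close> preserves
      the \<open>G\<close>-coordinate.\<close>
    have "(\<Sum>y\<in>T. f x y * S y z) = (\<Sum>k<m. f (a, i) (b, k) * M $$ (k, j))"
      using lt by (simp add: collapse xz S_def pull if_distrib[of "\<lambda>t. _ * t"]
          cong: if_cong)
    also have "\<dots> = (\<Sum>k<m. (if a = b then adj_mat F vs $$ (i, k) * M $$ (k, j) else 0)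
        + (if ?arc a b then perm_mat vs (?volt a b) $$ (i, k) * M $$ (k, j) else 0)
        - (if i = k then if a = b then \<mu> * (?deg a + of_nat r) * M $$ (k, j) else 0 else 0))"
      by (intro sum.cong) (auto simp: f_def algebra_simps)
    also have "\<dots> = (if a = b then M $$ (i, j) * lamF j else 0)
        + (if ?arc a b then M $$ (i, j) * lam (?volt a b) j else 0)
        - (if a = b then \<mu> * (?deg a + of_nat r) * M $$ (i, j) else 0)"
      unfolding sum.distrib sum_subtractf pull using lt FM PM by simp
    also have "\<dots> = M $$ (i, j) * c j a b"
      by (simp add: c_def algebra_simps)
    \<comment> \<open>Here \<open>S\<close> forces the \<open>G\<close>-coordinate \<open>a\<close>
      and \<open>g\<close> the second coordinate \<open>j\<close>, so \<open>y = (a, j)\<close> is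
      the only term.\<close>
    also have "\<dots> = (\<Sum>y\<in>T. S x y * g y z)"
      using lt by (simp add: collapse xz S_def g_def pull if_distrib[of "\<lambda>t. _ * t"]
          if_distrib[of "\<lambda>t. t * _"] cong: if_cong)
    finally show "(\<Sum>y\<in>T. f x y * S y z) = (\<Sum>y\<in>T. S x y * g y z)" .
  qed
qed

end
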